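(* Fix a real number $r\ge1$, and let $G=(V,E)$ be a finite simple graph with fractionally $r$-colorable neighborhoods. Then, for every real $\lambda>0$, $$\log Z_G(\lambda)\ge\sum_{v\in V}\frac{\mathcal A\bigl(W(K(r)d(v)\log(1+\lambda))\bigr)}{K(r)d(v)},$$ where the summand for $d(v)=0$ is interpreted by continuity as $\log(1+\lambda)$.
   Context: All graphs are finite and simple; $\log$ is the natural logarithm. $N(v)$ is the set of neighbors of $v$ and $d(v)=|N(v)|$. $\mathcal I(G)$ is the set of independent sets of $G$ including $\emptyset$, and $Z_G(\lambda)=\sum_{I\in\mathcal I(G)}\lambda^{|I|}$. The neighborhoods of $G$ are fractionally $r$-colorable if for each $v\in V$ there is a probability distribution on $\mathcal I(G[N(v)])$ under which every vertex of $N(v)$ belongs to the random independent set with probability exactly $1/r$. For $r\ge1$, $K(r)$ is the unique $K\ge1$ satisfying $K-1=\log(rK)$. $\mathcal A(x)=x^2/2+x$. $W$ is the principal nonnegative branch of the Lambert function: for $z\ge0$, $W(z)\ge0$ and $W(z)e^{W(z)}=z$. *)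

theory Defs
  imports "HOL-Probability.Probability" "Graph_Theory.Graph_Theory"
begin

text \<open>
  A finite simple graph is a digraph satisfying the locale \<^locale>\<open>graph\<close>: finite, without loops
  and parallel arcs, and symmetric. An undirected edge is thus a pair of opposite arcs, and degrees
  are counted through neighborhoods rather than through arcs. The definitions below are stated for
  raw digraphs and are meaningful under that locale.
\<close>

definition nbhd :: "('a, 'b) pre_digraph \<Rightarrow> 'a \<Rightarrow> 'a set" where
  "nbhd G v = {u. v \<rightarrow>\<^bsub>G\<^esub> u}"

definition deg :: "('a, 'b) pre_digraph \<Rightarrow> 'a \<Rightarrow> nat" where
  "deg G v = card (nbhd G v)"

definition indep_sets_of :: "('a, 'b) pre_digraph \<Rightarrow> 'a set set" where
  "indep_sets_of G = {I. I \<subseteq> verts G \<and> (\<forall>u\<in>I. \<forall>v\<in>I. \<not> u \<rightarrow>\<^bsub>G\<^esub> v)}"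

definition indep_poly :: "('a, 'b) pre_digraph \<Rightarrow> real \<Rightarrow> real" where
  "indep_poly G lam = (\<Sum>I\<in>indep_sets_of G. lam ^ card I)"

definition frac_colorable_nbhds :: "('a, 'b) pre_digraph \<Rightarrow> real \<Rightarrow> bool" where
  "frac_colorable_nbhds G r \<longleftrightarrow>
     (\<forall>v\<in>verts G. \<exists>p :: 'a set pmf.
        set_pmf p \<subseteq> indep_sets_of (G \<restriction> nbhd G v) \<and>
        (\<forall>u\<in>nbhd G v. measure_pmf.prob p {I. u \<in> I} = 1 / r))"

definition K_of :: "real \<Rightarrow> real" where
  "K_of r = (THE K. K \<ge> 1 \<and> K - 1 = ln (r * K))"

definition area :: "real \<Rightarrow> real" where
  "area x = x\<^sup>2 / 2 + x"

definition lambert_W :: "real \<Rightarrow> real" where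
  "lambert_W z = (THE w. w \<ge> 0 \<and> w * exp w = z)"

text \<open>The case \<open>d = 0\<close> is the continuous extension; see \<open>area_lambert_W_tendsto\<close>.\<close>

definition local_term :: "real \<Rightarrow> nat \<Rightarrow> real \<Rightarrow> real" where
  "local_term r d lam =
     (if d = 0 then ln (1 + lam)
      else area (lambert_W (K_of r * real d * ln (1 + lam))) / (K_of r * real d))"

lemma K_of_ex1:
  fixes r :: real
  assumes "r \<ge> 1"
  shows "\<exists>!K. K \<ge> 1 \<and> K - 1 = ln (r * K)"
proof -
  define f where "f = (\<lambda>K::real. K - 1 - ln K)"
  have mono: "f a < f b" if "1 \<le> a" "a < b" for a b :: real
  proof (rule DERIV_pos_imp_increasing_open[OF that(2)])
    fix x assume x: "a < x" "x < b"
    have "(f has_real_derivative 1 - 1 / x) (at x)"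
      unfolding f_def using x that by (auto intro!: derivative_eq_intros simp: field_simps)
    then show "\<exists>y. (f has_real_derivative y) (at x) \<and> y > 0"
      using x that by (intro exI[of _ "1 - 1 / x"]) auto
  next
    show "continuous_on {a..b} f"
      unfolding f_def using that by (auto intro!: continuous_intros)
  qed
  have eq: "K - 1 = ln (r * K) \<longleftrightarrow> f K = ln r" if "K \<ge> 1" for K :: real
    using assms that by (auto simp: f_def ln_mult)
  define M where "M = exp 2 * r"
  have M: "M \<ge> 1" using assms exp_ge_add_one_self[of 2] mult_mono[of 1 "exp 2" 1 r]
    by (simp add: M_def)
  have "ln r \<ge> 0" "ln r \<le> r - 1" using assms ln_le_minus_one by auto
  moreover have "3 * r \<le> exp 2 * r"
    using assms exp_ge_add_one_self[of 2] by (intro mult_right_mono) auto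
  moreover have "f M = exp 2 * r - 3 - ln r"
    using assms by (simp add: f_def M_def ln_mult)
  ultimately have "f M \<ge> ln r" by linarith
  moreover have "f 1 \<le> ln r" using assms by (simp add: f_def)
  moreover have "continuous_on {1..M} f"
    unfolding f_def by (auto intro!: continuous_intros)
  ultimately obtain K where K: "1 \<le> K" "f K = ln r"
    using IVT'[of f 1 "ln r" M] M by auto
  show ?thesis
  proof (rule ex1I[of _ K])
    show "K \<ge> 1 \<and> K - 1 = ln (r * K)" using K eq by simp
    fix L assume "L \<ge> 1 \<and> L - 1 = ln (r * L)"
    then have "L \<ge> 1" "f L = ln r" using eq by auto
    then show "L = K" using mono[of L K] mono[of K L] K by (cases L K rule: linorder_cases) auto
  qed
qed

lemma K_of_props:
  assumes "r \<ge> 1"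
  shows "K_of r \<ge> 1" "K_of r - 1 = ln (r * K_of r)"
  using theI'[OF K_of_ex1[OF assms]] unfolding K_of_def by auto

lemma lambert_W_ex1:
  fixes z :: real
  assumes "z \<ge> 0"
  shows "\<exists>!w. w \<ge> 0 \<and> w * exp w = z"
proof -
  have mono: "a * exp a < b * exp b" if "0 \<le> a" "a < b" for a b :: real
    using that by (intro mult_strict_mono') auto
  have "continuous_on {0..z} (\<lambda>w. w * exp w)" by (intro continuous_intros)
  moreover have "z \<le> z * exp z" using assms mult_left_mono[of 1 "exp z" z] by simp
  ultimately obtain w where w: "0 \<le> w" "w * exp w = z"
    using IVT'[of "\<lambda>w. w * exp w" 0 z z] assms by auto
  show ?thesis
  proof (rule ex1I[of _ w])
    show "w \<ge> 0 \<and> w * exp w = z" using w by simp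
    fix u assume "u \<ge> 0 \<and> u * exp u = z"
    then show "u = w" using mono[of u w] mono[of w u] w by (cases u w rule: linorder_cases) auto
  qed
qed

lemma lambert_W_props:
  assumes "z \<ge> 0"
  shows "lambert_W z \<ge> 0" "lambert_W z * exp (lambert_W z) = z"
  using theI'[OF lambert_W_ex1[OF assms]] unfolding lambert_W_def by auto

lemma area_lambert_W_tendsto:
  assumes "c > 0"
  shows "((\<lambda>t. area (lambert_W (t * c)) / t) \<longlongrightarrow> c) (at_right 0)"
proof -
  have le: "lambert_W z \<le> z" if "z \<ge> 0" for z
    using lambert_W_props[OF that] mult_left_mono[of 1 "exp (lambert_W z)" "lambert_W z"] by simp
  have lim: "((\<lambda>t. t * c) \<longlongrightarrow> 0) (at_right 0)"
    using tendsto_mult_left_zero[OF tendsto_ident_at] .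
  have "\<forall>\<^sub>F t in at_right 0. 0 \<le> lambert_W (t * c)"
    by (rule eventually_mono[OF eventually_at_right_less[of 0]])
      (use assms lambert_W_props(1) in simp)
  moreover have "\<forall>\<^sub>F t in at_right 0. lambert_W (t * c) \<le> t * c"
    by (rule eventually_mono[OF eventually_at_right_less[of 0]]) (use assms le in simp)
  ultimately have W: "((\<lambda>t. lambert_W (t * c)) \<longlongrightarrow> 0) (at_right 0)"
    by (rule tendsto_sandwich[OF _ _ tendsto_const lim])
  have "((\<lambda>t. c * (lambert_W (t * c) / 2 + 1) / exp (lambert_W (t * c))) \<longlongrightarrow>
      c * (0 / 2 + 1) / exp 0) (at_right 0)"
    by (rule tendsto_divide[OF tendsto_mult[OF tendsto_const
          tendsto_add[OF tendsto_divide[OF W tendsto_const] tendsto_const]] tendsto_exp[OF W]]) auto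
  moreover have "\<forall>\<^sub>F t in at_right 0.
      c * (lambert_W (t * c) / 2 + 1) / exp (lambert_W (t * c)) = area (lambert_W (t * c)) / t"
  proof (rule eventually_mono[OF eventually_at_right_less[of 0]])
    fix t :: real assume t: "0 < t"
    define w where "w = lambert_W (t * c)"
    have w: "w * exp w = t * c" using lambert_W_props[of "t * c"] t assms by (simp add: w_def)
    have "t * (c * (w / 2 + 1)) = (w * exp w) * (w / 2 + 1)" by (simp add: w)
    also have "\<dots> = area w * exp w" by (simp add: area_def power2_eq_square algebra_simps)
    finally have "c * (w / 2 + 1) / exp w = area w / t" using t by (simp add: field_simps)
    then show "c * (lambert_W (t * c) / 2 + 1) / exp (lambert_W (t * c)) =
        area (lambert_W (t * c)) / t" by (simp add: w_def)
  qed
  ultimately have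
    "((\<lambda>t. area (lambert_W (t * c)) / t) \<longlongrightarrow> c * (0 / 2 + 1) / exp 0) (at_right 0)"
    by (rule Lim_transform_eventually)
  then show ?thesis by simp
qed

end

theory Submission
  imports Defs
begin

text \<open>
  Give each vertex \<open>v\<close> its own activity \<open>exp (t v) - 1\<close>. Then the derivative of the logarithm of the
  partition function in \<open>t v\<close> is \<open>q v\<close>, the probability that the random independent set of the hard-core
  model misses the neighborhood of \<open>v\<close>. The proof bounds these probabilities from below and integrates
  along a path of activities from \<open>0\<close> to the constant activity \<open>lam\<close>.

  Given the random set outside the neighborhood of \<open>v\<close>, the inside is a hard-core model on the set \<open>F\<close> of
  those neighbors that are still free, and it is empty with probability \<open>1 / Z\<close>, where \<open>Z\<close> is the partition
  function of \<open>F\<close>. The local input (\<open>ln_indep_gf_le\<close>) is that \<open>ln Z\<close> is at most \<open>K\<close> times its derivative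
  along the ray through \<open>t\<close>. Indeed the logarithm of the partition function at \<open>x * t\<close> is convex in \<open>ln x\<close>;
  at \<open>x = 1 / (r * K)\<close> it is at most \<open>x * (\<Sum>u\<in>F. t u)\<close>, and a fractional \<open>r\<close>-coloring provides an independent
  subset of \<open>F\<close> that shows this to be at most \<open>ln Z / K\<close>. The equation defining \<open>K\<close> says precisely that
  the resulting secant has slope at least \<open>ln Z / K\<close> (for \<open>K = 1\<close>, in the limit \<open>x\<close> to \<open>1\<close>). Averaging over the outside and using a tangent of the
  exponential function gives (\<open>indep_gf_minus_nbhd_ge\<close>), for every real \<open>w\<close>,
  \<open>exp w * q v \<ge> 1 + w - K * (\<Sum>u\<in>nb v. t u * q u)\<close>.

  Summed over \<open>v\<close> with an arbitrary choice of \<open>w v\<close>, the last terms collect to at most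
  \<open>K * d u * t u * q u\<close> for each \<open>u\<close>, where \<open>d\<close> denotes the degree. Hence the logarithm of the partition
  function grows at rate at least \<open>\<Sum>v. 1 + w v\<close> if each \<open>t v\<close> moves with velocity
  \<open>exp (w v) + K * d v * t v\<close>. For \<open>w v = K * d v * y\<close> at time \<open>y\<close> the solution is
  \<open>t v = y * exp (K * d v * y)\<close>, which reaches \<open>ln (1 + lam)\<close> when \<open>K * d v * y\<close> is the Lambert value in
  the statement, with total gain equal to the summand of \<open>v\<close>. Vertices of high degree need less time;
  starting them later makes all vertices arrive simultaneously, and vertices not yet started have
  \<open>t v = 0\<close> and cost nothing (\<open>ln_indep_gf_ge\<close>).
\<close>

section \<open>Scaling of activities\<close>

text \<open>
  The elasticity of the activity \<open>exp t - 1\<close>: its logarithmic derivative with respect to \<open>ln t\<close>.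
  At \<open>t = 0\<close> it takes the value \<open>0\<close> instead of the limit \<open>1\<close>; the activity is \<open>0\<close> there, so expected
  elasticities do not see the difference.
\<close>
definition elast :: "real \<Rightarrow> real" where
  "elast t = t / (1 - exp (- t))"

lemma elast_nonneg: "t \<ge> 0 \<Longrightarrow> elast t \<ge> 0"
  by (simp add: elast_def)

lemma elast_times: "t \<ge> 0 \<Longrightarrow> elast t * (exp t - 1) = t * exp t"
  by (cases "t = 0") (simp_all add: elast_def field_simps exp_minus)

text \<open>
  The sign of the derivative is that of \<open>1 - exp (- x) - x * exp (- x)\<close>, which is nonnegative by
  \<open>1 + x \<le> exp x\<close>.
\<close>
lemma elast_mono:
  assumes "0 < s" "s \<le> t"
  shows "elast s \<le> elast t"
proof (rule DERIV_nonneg_imp_nondecreasing[OF assms(2)])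
  fix x assume "s \<le> x" "x \<le> t"
  with assms have x: "x > 0" by simp
  have "(elast has_real_derivative ((1 - exp (- x)) - x * exp (- x)) / (1 - exp (- x))\<^sup>2) (at x)"
    unfolding elast_def using x
    by (auto intro!: derivative_eq_intros simp: power2_eq_square)
  moreover have "(1 + x) * exp (- x) \<le> exp x * exp (- x)"
    by (intro mult_right_mono exp_ge_add_one_self) auto
  then have "(1 - exp (- x)) - x * exp (- x) \<ge> 0"
    by (simp add: exp_minus algebra_simps)
  ultimately show "\<exists>y. (elast has_real_derivative y) (at x) \<and> y \<ge> 0"
    by (intro exI conjI) (auto intro!: divide_nonneg_nonneg)
qed

text \<open>
  In the variable \<open>ln x\<close>, the function \<open>ln (exp (x * t) - 1)\<close> has derivative \<open>elast (x * t)\<close>, which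
  is nondecreasing; so the function is convex and lies above its tangent at \<open>x = 1\<close>. This is that
  tangent inequality in exponentiated form; at \<open>t = 0\<close> both sides are \<open>0\<close>.
\<close>
lemma activity_scale:
  assumes t: "t \<ge> 0" and x: "0 < x" "x \<le> 1"
  shows "(exp t - 1) * exp (ln x * elast t) \<le> exp (x * t) - 1"
proof (cases "t = 0")
  case False
  with t have t: "t > 0" by simp
  define f where "f = (\<lambda>x. elast t * ln x - ln (exp (x * t) - 1))"
  have "f x \<le> f 1"
  proof (rule DERIV_nonneg_imp_nondecreasing[OF x(2)])
    fix y assume "x \<le> y" "y \<le> 1"
    with x have y: "0 < y" "y \<le> 1" by auto
    have yt: "exp (y * t) > 1" using y t by simp
    have "(f has_real_derivative elast t / y - t * exp (y * t) / (exp (y * t) - 1)) (at y)"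
      unfolding f_def using y yt by (auto intro!: derivative_eq_intros simp: field_simps)
    moreover have "t * exp (y * t) / (exp (y * t) - 1) = elast (y * t) / y"
      using elast_times[of "y * t"] y t yt by (simp add: field_simps)
    moreover have "elast (y * t) \<le> elast t"
      using y t by (intro elast_mono) (auto simp: mult_left_le_one_le)
    ultimately show "\<exists>z. (f has_real_derivative z) (at y) \<and> z \<ge> 0"
      using y by (intro exI conjI) (auto intro!: divide_right_mono)
  qed
  then have "ln x * elast t + ln (exp t - 1) \<le> ln (exp (x * t) - 1)"
    by (simp add: f_def algebra_simps)
  then have "exp (ln x * elast t + ln (exp t - 1)) \<le> exp (ln (exp (x * t) - 1))" by simp
  moreover have "exp (x * t) > 1" "exp t > 1" using x t by auto
  ultimately show ?thesis by (simp add: exp_add mult.commute)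
qed simp

text \<open>
  Needed because the path of activities used later has a corner whenever a vertex is switched on.
\<close>
lemma nondecreasing_except_finite:
  fixes f :: "real \<Rightarrow> real"
  assumes "finite S" "a \<le> b" "continuous_on {a..b} f"
    and "\<And>x. a < x \<Longrightarrow> x < b \<Longrightarrow> x \<notin> S \<Longrightarrow> \<exists>y. (f has_real_derivative y) (at x) \<and> y \<ge> 0"
  shows "f a \<le> f b"
  using assms
proof (induction S arbitrary: a b rule: finite_induct)
  case empty
  then show ?case by (intro DERIV_nonneg_imp_increasing_open[of a b f]) auto
next
  case (insert c S)
  show ?case
  proof (cases "a < c \<and> c < b")
    case True
    have "f a \<le> f c"
      by (rule insert.IH) (use True insert.prems in \<open>auto intro: continuous_on_subset\<close>)
    moreover have "f c \<le> f b"
      by (rule insert.IH) (use True insert.prems in \<open>auto intro: continuous_on_subset\<close>)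
    ultimately show ?thesis by simp
  next
    case False
    show ?thesis by (rule insert.IH) (use False insert.prems in auto)
  qed
qed

section \<open>Partition functions with vertex activities\<close>

text \<open>
  Parametrizing the activity of \<open>u\<close> as \<open>exp (t u) - 1\<close> makes an isolated vertex contribute exactly
  \<open>t u\<close> to the logarithm of the partition function.
\<close>
definition wt :: "('a \<Rightarrow> real) \<Rightarrow> 'a set \<Rightarrow> real" where
  "wt t I = (\<Prod>u\<in>I. exp (t u) - 1)"

lemma wt_nonneg: "(\<And>u. t u \<ge> 0) \<Longrightarrow> wt t I \<ge> 0"
  by (simp add: wt_def prod_nonneg)

lemma wt_empty [simp]: "wt t {} = 1"
  by (simp add: wt_def)

lemma sum_wt_Pow:
  assumes "finite A"
  shows "(\<Sum>I\<in>Pow A. wt t I) = exp (\<Sum>u\<in>A. t u)"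
  using prod_add[OF assms, of "\<lambda>u. exp (t u) - 1" "\<lambda>_. 1"]
  by (simp add: wt_def exp_sum[OF assms])

locale fin_simple_graph =
  fixes V :: "'a set" and adj :: "'a \<Rightarrow> 'a \<Rightarrow> bool"
  assumes finite_V: "finite V"
    and adj_sym: "adj u v \<Longrightarrow> adj v u"
    and adj_irrefl: "\<not> adj u u"
begin

definition nb :: "'a \<Rightarrow> 'a set" where
  "nb v = {u\<in>V. adj v u}"

definition indeps :: "'a set \<Rightarrow> 'a set set" where
  "indeps W = {I. I \<subseteq> W \<and> (\<forall>u\<in>I. \<forall>v\<in>I. \<not> adj u v)}"

text \<open>
  The multivariate independence polynomial of the subgraph induced on \<open>W\<close>, that is, the partition
  function of the hard-core model there.
\<close>
definition indep_gf :: "('a \<Rightarrow> real) \<Rightarrow> 'a set \<Rightarrow> real" where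
  "indep_gf t W = (\<Sum>I\<in>indeps W. wt t I)"

lemma finite_indeps: "finite W \<Longrightarrow> finite (indeps W)"
  unfolding indeps_def by (rule finite_subset[of _ "Pow W"]) auto

lemma empty_in_indeps: "{} \<in> indeps W"
  by (simp add: indeps_def)

lemma indep_gf_ge_1:
  assumes "finite W" "\<And>u. t u \<ge> 0"
  shows "indep_gf t W \<ge> 1"
  using member_le_sum[of "{}" "indeps W" "wt t"] assms
  by (simp add: indep_gf_def empty_in_indeps finite_indeps wt_nonneg)

lemma indep_gf_le_exp:
  assumes "finite W" "\<And>u. t u \<ge> 0"
  shows "indep_gf t W \<le> exp (\<Sum>u\<in>W. t u)"
  unfolding indep_gf_def sum_wt_Pow[OF assms(1), symmetric]
  by (rule sum_mono2) (use assms in \<open>auto simp: indeps_def wt_nonneg\<close>)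

lemma exp_le_indep_gf:
  assumes "finite W" "\<And>u. t u \<ge> 0" "A \<in> indeps W"
  shows "exp (\<Sum>u\<in>A. t u) \<le> indep_gf t W"
proof -
  have "finite A" using assms by (auto simp: indeps_def intro: finite_subset)
  moreover have "Pow A \<subseteq> indeps W" using assms(3) by (auto simp: indeps_def)
  ultimately show ?thesis
    unfolding indep_gf_def sum_wt_Pow[OF \<open>finite A\<close>, symmetric]
    by (intro sum_mono2) (use assms in \<open>auto simp: finite_indeps wt_nonneg\<close>)
qed

section \<open>Expected size against partition function\<close>

text \<open>
  The logarithm of the partition function along the ray \<open>x * t\<close> is convex in \<open>ln x\<close>, since each
  weight is a product of log-convex functions. The lemma is the tangent at \<open>x = 1\<close>, whose slope is the
  expected total elasticity of the random independent set. It follows from Jensen's inequality for the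
  hard-core measure: \<open>m\<close> is the mean exponent, and \<open>exp c\<close> is bounded below by its tangent at \<open>m\<close>.
\<close>
lemma indep_gf_scale:
  assumes F: "finite F" and t: "\<And>u. t u \<ge> 0" and x: "0 < x" "x \<le> 1"
  shows "ln (indep_gf t F) + ln x * ((\<Sum>I\<in>indeps F. wt t I * (\<Sum>u\<in>I. elast (t u))) / indep_gf t F)
    \<le> ln (indep_gf (\<lambda>u. x * t u) F)"
proof -
  define Z where "Z = indep_gf t F"
  define S where "S = (\<Sum>I\<in>indeps F. wt t I * (\<Sum>u\<in>I. elast (t u)))"
  define m where "m = ln x * (S / Z)"
  have Z: "Z \<ge> 1" unfolding Z_def by (rule indep_gf_ge_1[OF F t])
  have "Z * exp m = exp m * (Z + ln x * S - m * Z)"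
    using Z by (simp add: m_def)
  also have "\<dots> = (\<Sum>I\<in>indeps F. wt t I * (exp m * (1 + (ln x * (\<Sum>u\<in>I. elast (t u)) - m))))"
    unfolding Z_def S_def indep_gf_def
    by (simp add: sum.distrib sum_subtractf sum_distrib_left algebra_simps)
  also have "\<dots> \<le> (\<Sum>I\<in>indeps F. wt (\<lambda>u. x * t u) I)"
  proof (rule sum_mono)
    fix I assume "I \<in> indeps F"
    then have I: "finite I" using F by (auto simp: indeps_def intro: finite_subset)
    define c where "c = ln x * (\<Sum>u\<in>I. elast (t u))"
    have "exp m * (1 + (c - m)) \<le> exp m * exp (c - m)"
      by (intro mult_left_mono exp_ge_add_one_self) auto
    also have "\<dots> = exp c" by (simp flip: exp_add)
    finally have "wt t I * (exp m * (1 + (c - m))) \<le> wt t I * exp c"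
      by (intro mult_left_mono wt_nonneg t)
    also have "\<dots> = (\<Prod>u\<in>I. (exp (t u) - 1) * exp (ln x * elast (t u)))"
      using I by (simp add: wt_def c_def exp_sum sum_distrib_left prod.distrib)
    also have "\<dots> \<le> wt (\<lambda>u. x * t u) I"
      unfolding wt_def by (intro prod_mono conjI mult_nonneg_nonneg activity_scale t x) (simp_all add: t)
    finally show "wt t I * (exp m * (1 + (ln x * (\<Sum>u\<in>I. elast (t u)) - m))) \<le> wt (\<lambda>u. x * t u) I"
      by (simp add: c_def)
  qed
  finally have "Z * exp m \<le> indep_gf (\<lambda>u. x * t u) F" by (simp add: indep_gf_def)
  then have "ln (Z * exp m) \<le> ln (indep_gf (\<lambda>u. x * t u) F)"
    using Z by (subst ln_le_cancel_iff) (auto intro: less_le_trans[rotated])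
  then show ?thesis using Z by (simp add: ln_mult m_def Z_def S_def)
qed

text \<open>
  If the partition function is large, the random independent set is large on average. Write \<open>L\<close> for
  its logarithm and \<open>D\<close> for the expected total elasticity. A set \<open>A\<close> of weight at least \<open>1 / r\<close> times
  that of \<open>F\<close> gives \<open>L \<ge> (\<Sum>u\<in>A. t u)\<close>, so the upper bound
  \<open>exp (x * (\<Sum>u\<in>F. t u))\<close> for the partition function at \<open>x * t\<close> is at most \<open>exp (x * r * L)\<close>. Comparing with the tangent at \<open>x = 1\<close> yields
  \<open>L + ln x * D \<le> x * r * L\<close>. The choice \<open>x = 1 / (r * K)\<close> turns this into
  \<open>(1 - 1 / K) * L \<le> (K - 1) * D\<close>, exactly because \<open>ln (r * K) = K - 1\<close>.
\<close>
lemma ln_indep_gf_le: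
  assumes F: "finite F" and t: "\<And>u. t u \<ge> 0"
    and r: "r \<ge> 1" and K: "K \<ge> 1" "K - 1 = ln (r * K)"
    and A: "A \<in> indeps F" "(\<Sum>u\<in>F. t u) \<le> r * (\<Sum>u\<in>A. t u)"
  shows "indep_gf t F * ln (indep_gf t F) \<le> K * (\<Sum>I\<in>indeps F. wt t I * (\<Sum>u\<in>I. elast (t u)))"
proof -
  define L where "L = ln (indep_gf t F)"
  define S where "S = (\<Sum>I\<in>indeps F. wt t I * (\<Sum>u\<in>I. elast (t u)))"
  define D where "D = S / indep_gf t F"
  have Z: "indep_gf t F \<ge> 1" by (rule indep_gf_ge_1[OF F t])
  have "(\<Sum>u\<in>A. t u) \<le> L"
    using exp_le_indep_gf[OF F t A(1)] Z by (simp add: L_def ln_ge_iff)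
  with A(2) r have tF: "(\<Sum>u\<in>F. t u) \<le> r * L"
    by (meson mult_left_mono order_trans zero_le_one)
  have main: "L + ln x * D \<le> x * (r * L)" if x: "0 < x" "x \<le> 1" for x
  proof -
    have "indep_gf (\<lambda>u. x * t u) F \<ge> 1" by (intro indep_gf_ge_1 F) (use x t in simp)
    moreover have "indep_gf (\<lambda>u. x * t u) F \<le> exp (\<Sum>u\<in>F. x * t u)"
      by (intro indep_gf_le_exp F) (use x t in simp)
    ultimately have "ln (indep_gf (\<lambda>u. x * t u) F) \<le> x * (\<Sum>u\<in>F. t u)"
      by (metis exp_gt_zero ln_exp ln_le_cancel_iff less_le_trans sum_distrib_left zero_less_one)
    also have "\<dots> \<le> x * (r * L)" using x tF by (intro mult_left_mono) auto
    finally show ?thesis using indep_gf_scale[of F t x, OF F t x] by (simp add: L_def D_def S_def)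
  qed
  have "L \<le> K * D"
  proof (cases "K = 1")
    case True
    with K r have r1: "r = 1" by simp
    \<comment> \<open>The choice \<open>x = 1 / (r * K) = 1\<close> gives only \<open>0 \<le> 0\<close>; the bound comes from letting \<open>x\<close> tend to \<open>1\<close>.\<close>
    have "L \<le> D"
    proof (rule field_le_mult_one_interval)
      fix x :: real assume x: "0 < x" "x < 1"
      have D: "D \<ge> 0"
        unfolding D_def S_def using Z t
        by (intro divide_nonneg_nonneg sum_nonneg mult_nonneg_nonneg wt_nonneg elast_nonneg) auto
      have "- ln x \<le> 1 / x - 1" using ln_le_minus_one[of "1 / x"] x by (simp add: ln_div)
      then have "- ln x * D \<le> (1 / x - 1) * D" using D by (intro mult_right_mono)
      moreover have "(1 - x) * L \<le> - ln x * D" using main[of x] x r1 by (simp add: algebra_simps)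
      ultimately have "(1 - x) * L \<le> (1 / x - 1) * D" by linarith
      then have "(1 - x) * (x * L) \<le> (1 - x) * D" using x by (simp add: field_simps)
      then show "x * L \<le> D" using x by (simp add: mult_le_cancel_left)
    qed
    then show ?thesis using True by simp
  next
    case False
    with K have K1: "K > 1" by simp
    have rK: "r * K \<ge> 1" using mult_mono[of 1 r 1 K] r K by simp
    have "ln (1 / (r * K)) = - (K - 1)" unfolding K(2) using rK by (subst ln_div) auto
    moreover have "0 < 1 / (r * K)" "1 / (r * K) \<le> 1" using rK by auto
    ultimately have "L - (K - 1) * D \<le> 1 / (r * K) * (r * L)"
      using main[of "1 / (r * K)"] by (simp only: mult_minus_left flip: diff_conv_add_uminus)
    also have "\<dots> = L / K" using r by simp
    finally have "(K - 1) * L \<le> (K - 1) * (K * D)" using K1 by (simp add: field_simps)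
    then show ?thesis using K1 by simp
  qed
  then show ?thesis using Z unfolding D_def S_def L_def by (simp add: field_simps)
qed

lemma indep_gf_pos:
  assumes "finite W" "\<And>u. t u \<ge> 0"
  shows "indep_gf t W > 0"
  using indep_gf_ge_1[of W t, OF assms] by simp

section \<open>Uncovered vertices\<close>

text \<open>
  Spatial Markov property: given the part \<open>J\<close> of the independent set outside \<open>N\<close>, the part inside
  \<open>N\<close> follows the hard-core model on the vertices of \<open>N\<close> without a neighbor in \<open>J\<close>.
\<close>
lemma sum_indeps_split:
  assumes N: "N \<subseteq> V"
  shows "(\<Sum>I\<in>indeps V. wt t I * g (I \<inter> N)) =
    (\<Sum>J\<in>indeps (V - N). wt t J *
      (\<Sum>B\<in>indeps {u\<in>N. \<forall>w\<in>J. \<not> adj u w}. wt t B * g B))"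
proof -
  let ?F = "\<lambda>J. {u\<in>N. \<forall>w\<in>J. \<not> adj u w}"
  let ?S = "SIGMA J : indeps (V - N). indeps (?F J)"
  have finN: "finite N" using N finite_V by (rule finite_subset)
  have "(\<Sum>J\<in>indeps (V - N). wt t J * (\<Sum>B\<in>indeps (?F J). wt t B * g B)) =
      (\<Sum>(J, B)\<in>?S. wt t J * (wt t B * g B))"
    unfolding sum_distrib_left
    by (subst sum.Sigma) (use finN finite_V in \<open>auto intro!: finite_indeps\<close>)
  also have "\<dots> = (\<Sum>I\<in>indeps V. wt t I * g (I \<inter> N))"
  proof (rule sum.reindex_bij_witness[of _ "\<lambda>I. (I - N, I \<inter> N)" "\<lambda>(J, B). J \<union> B"])
    fix p assume p: "p \<in> ?S"
    obtain J B where [simp]: "p = (J, B)" by (cases p)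
    from p have J: "J \<subseteq> V - N" "B \<subseteq> N"
      and ind: "J \<in> indeps (V - N)" "B \<in> indeps (?F J)"
      by (auto simp: indeps_def)
    have fin: "finite J" "finite B" using J finN finite_V by (auto intro: finite_subset)
    have "\<not> adj b j" "\<not> adj j b" if "j \<in> J" "b \<in> B" for j b
      using ind that adj_sym[of j b] by (auto simp: indeps_def)
    then show "(case p of (J, B) \<Rightarrow> J \<union> B) \<in> indeps V"
      using J ind N by (auto simp: indeps_def)
    show "((case p of (J, B) \<Rightarrow> J \<union> B) - N, (case p of (J, B) \<Rightarrow> J \<union> B) \<inter> N) = p"
      using J by auto
    have "(J \<union> B) \<inter> N = B" using J by auto
    moreover have "wt t (J \<union> B) = wt t J * wt t B"
      unfolding wt_def by (rule prod.union_disjoint) (use fin J in auto)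
    ultimately show "wt t (case p of (J, B) \<Rightarrow> J \<union> B) * g ((case p of (J, B) \<Rightarrow> J \<union> B) \<inter> N) =
        (case p of (J, B) \<Rightarrow> wt t J * (wt t B * g B))"
      by simp
  next
    fix I assume "I \<in> indeps V"
    then show "(I - N, I \<inter> N) \<in> ?S" by (auto simp: indeps_def)
  qed auto
  finally show ?thesis by simp
qed

lemma insert_in_indeps:
  assumes u: "u \<in> V" and J: "J \<in> indeps (V - nb u - {u})"
  shows "insert u J \<in> indeps (V - nb u)"
proof -
  have J': "J \<subseteq> V - nb u - {u}" "\<forall>x\<in>J. \<forall>y\<in>J. \<not> adj x y"
    using J by (simp_all add: indeps_def)
  then have 1: "\<forall>w\<in>J. \<not> adj u w" unfolding nb_def by blast
  then have 2: "\<forall>w\<in>J. \<not> adj w u" using adj_sym by blast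
  have "u \<notin> nb u" by (simp add: nb_def adj_irrefl)
  with J' u have "insert u J \<subseteq> V - nb u" by blast
  with J' 1 2 show ?thesis by (simp add: indeps_def adj_irrefl)
qed

lemma remove_in_indeps:
  assumes "I \<in> indeps V" "u \<in> I"
  shows "I - {u} \<in> indeps (V - nb u - {u})"
  using assms unfolding indeps_def nb_def by blast

lemma indeps_mono: "W \<subseteq> W' \<Longrightarrow> indeps W \<subseteq> indeps W'"
  unfolding indeps_def by blast

lemma sum_indeps_remove:
  assumes "u \<in> V"
  shows "(\<Sum>I | I \<in> indeps V \<and> u \<in> I. h (I - {u})) = (\<Sum>J\<in>indeps (V - nb u - {u}). h J)"
proof (rule sum.reindex_bij_witness[of _ "insert u" "\<lambda>I. I - {u}"])
  fix J assume J: "J \<in> indeps (V - nb u - {u})"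
  show "insert u J \<in> {I. I \<in> indeps V \<and> u \<in> I}"
    using insert_in_indeps[OF assms J] indeps_mono[of "V - nb u" V] by blast
  show "insert u J - {u} = J" using J unfolding indeps_def by blast
next
  fix I assume "I \<in> {I. I \<in> indeps V \<and> u \<in> I}"
  then show "I - {u} \<in> indeps (V - nb u - {u})" "insert u (I - {u}) = I"
    using remove_in_indeps by auto
qed simp

text \<open>
  After deletion of its neighbors, \<open>u\<close> is isolated and contributes a factor
  \<open>1 + (exp (t u) - 1) = exp (t u)\<close>.
\<close>
lemma indep_gf_minus_nb:
  assumes u: "u \<in> V"
  shows "indep_gf t (V - nb u) = exp (t u) * indep_gf t (V - nb u - {u})"
proof -
  let ?W = "V - nb u - {u}"
  have eq: "indeps (V - nb u) = indeps ?W \<union> insert u ` indeps ?W" (is "?L = ?R")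
  proof
    show "?L \<subseteq> ?R"
    proof
      fix I assume I: "I \<in> ?L"
      then have "I - {u} \<in> indeps ?W" by (auto simp: indeps_def)
      then show "I \<in> ?R"
        by (cases "u \<in> I") (auto simp: insert_absorb intro!: rev_image_eqI[of "I - {u}"])
    qed
    show "?R \<subseteq> ?L"
      using insert_in_indeps[OF u] indeps_mono[of ?W "V - nb u"] by blast
  qed
  have fin: "finite (indeps ?W)" using finite_V by (intro finite_indeps) auto
  have inj: "inj_on (insert u) (indeps ?W)"
    by (rule inj_onI) (auto simp: indeps_def)
  have "indep_gf t (V - nb u) = (\<Sum>I\<in>indeps ?W. wt t I) + (\<Sum>I\<in>insert u ` indeps ?W. wt t I)"
    unfolding indep_gf_def eq by (rule sum.union_disjoint) (use fin in \<open>auto simp: indeps_def\<close>)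
  also have "(\<Sum>I\<in>insert u ` indeps ?W. wt t I) = (\<Sum>I\<in>indeps ?W. (exp (t u) - 1) * wt t I)"
  proof (subst sum.reindex[OF inj], rule sum.cong[OF refl])
    fix I assume "I \<in> indeps ?W"
    then have "finite I" "u \<notin> I" using finite_V by (auto simp: indeps_def intro: finite_subset)
    then show "(wt t \<circ> insert u) I = (exp (t u) - 1) * wt t I" by (simp add: wt_def)
  qed
  finally show ?thesis by (simp add: indep_gf_def flip: sum_distrib_left) (simp add: algebra_simps)
qed

text \<open>
  Translates occupation into non-coverage. The ratio of \<open>indep_gf t (V - nb u)\<close> to \<open>indep_gf t V\<close> is the
  probability that no neighbor of \<open>u\<close> is occupied, and \<open>u\<close> itself is occupied with \<open>1 - exp (- t u)\<close>
  times that probability; multiplying by the elasticity leaves the factor \<open>t u\<close>.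
\<close>
lemma sum_elast_occupied:
  assumes N: "N \<subseteq> V" and t: "\<And>u. t u \<ge> 0"
  shows "(\<Sum>I\<in>indeps V. wt t I * (\<Sum>u\<in>I \<inter> N. elast (t u))) = (\<Sum>u\<in>N. t u * indep_gf t (V - nb u))"
proof -
  have finN: "finite N" using N finite_V by (rule finite_subset)
  have fin: "finite (indeps V)" by (rule finite_indeps[OF finite_V])
  have "(\<Sum>I\<in>indeps V. wt t I * (\<Sum>u\<in>I \<inter> N. elast (t u))) =
      (\<Sum>I\<in>indeps V. \<Sum>u\<in>N. if u \<in> I then wt t I * elast (t u) else 0)"
    by (simp add: sum_distrib_left sum.inter_restrict[OF finN] Int_commute[of _ N] if_distrib cong: if_cong)
  also have "\<dots> = (\<Sum>u\<in>N. \<Sum>I | I \<in> indeps V \<and> u \<in> I. wt t I * elast (t u))"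
    by (subst sum.swap) (simp add: sum.If_cases fin Collect_conj_eq)
  also have "\<dots> = (\<Sum>u\<in>N. t u * indep_gf t (V - nb u))"
  proof (rule sum.cong[OF refl])
    fix u assume "u \<in> N"
    with N have u: "u \<in> V" by auto
    have "wt t I * elast (t u) = t u * exp (t u) * wt t (I - {u})" if I: "I \<in> indeps V" "u \<in> I" for I
    proof -
      have "finite I" using I finite_V by (auto simp: indeps_def intro: finite_subset)
      then have "wt t I = (exp (t u) - 1) * wt t (I - {u})"
        using I unfolding wt_def by (subst prod.remove[of _ u]) auto
      then show ?thesis using elast_times[OF t[of u]] by (simp add: mult.commute mult.left_commute)
    qed
    then have "(\<Sum>I | I \<in> indeps V \<and> u \<in> I. wt t I * elast (t u)) =
        (\<Sum>I | I \<in> indeps V \<and> u \<in> I. t u * exp (t u) * wt t (I - {u}))" by (intro sum.cong) auto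
    also have "\<dots> = t u * exp (t u) * indep_gf t (V - nb u - {u})"
      unfolding indep_gf_def sum_distrib_left by (rule sum_indeps_remove[OF u])
    finally show "(\<Sum>I | I \<in> indeps V \<and> u \<in> I. wt t I * elast (t u)) = t u * indep_gf t (V - nb u)"
      using indep_gf_minus_nb[OF u] by simp
  qed
  finally show ?thesis .
qed

text \<open>
  With \<open>Z\<close> the partition function of the free part of \<open>N\<close>, the set \<open>N\<close> is empty with conditional
  probability \<open>1 / Z = exp (- ln Z) \<ge> exp (- w) * (1 + w - ln Z)\<close>. Averaging over the configuration
  outside \<open>N\<close> and bounding \<open>ln Z\<close> through \<open>ln_indep_gf_le\<close> gives, after division by
  \<open>indep_gf t V\<close>, a linear relation between the probabilities that vertices are not covered by
  neighbors. The tangent point \<open>w\<close> is free.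
\<close>
lemma indep_gf_minus_nbhd_ge:
  assumes N: "N \<subseteq> V" and t: "\<And>u. t u \<ge> 0"
    and r: "r \<ge> 1" and K: "K \<ge> 1" "K - 1 = ln (r * K)"
    and A: "\<And>F. F \<subseteq> N \<Longrightarrow> \<exists>A\<in>indeps F. (\<Sum>u\<in>F. t u) \<le> r * (\<Sum>u\<in>A. t u)"
  shows "exp w * indep_gf t (V - N) \<ge> (1 + w) * indep_gf t V - K * (\<Sum>u\<in>N. t u * indep_gf t (V - nb u))"
proof -
  let ?F = "\<lambda>J. {u\<in>N. \<forall>w\<in>J. \<not> adj u w}"
  define E where "E = (\<lambda>J. \<Sum>B\<in>indeps (?F J). wt t B * (\<Sum>u\<in>B. elast (t u)))"
  have finN: "finite N" using N finite_V by (rule finite_subset)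
  have ZV: "indep_gf t V = (\<Sum>J\<in>indeps (V - N). wt t J * indep_gf t (?F J))"
    using sum_indeps_split[OF N, of t "\<lambda>_. 1"] by (simp add: indep_gf_def)
  have EN: "(\<Sum>u\<in>N. t u * indep_gf t (V - nb u)) = (\<Sum>J\<in>indeps (V - N). wt t J * E J)"
    using sum_indeps_split[OF N, of t "\<lambda>B. \<Sum>u\<in>B. elast (t u)"] sum_elast_occupied[of N t, OF N t]
    by (simp add: E_def)
  have "(1 + w) * indep_gf t V - K * (\<Sum>u\<in>N. t u * indep_gf t (V - nb u)) =
     (\<Sum>J\<in>indeps (V - N). wt t J * ((1 + w) * indep_gf t (?F J) - K * E J))"
    unfolding ZV EN by (simp add: sum_distrib_left sum_subtractf algebra_simps)
  also have "\<dots> \<le> (\<Sum>J\<in>indeps (V - N). wt t J * exp w)"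
  proof (intro sum_mono mult_left_mono wt_nonneg t)
    fix J
    have fin: "finite (?F J)" using finN by simp
    define Z where "Z = indep_gf t (?F J)"
    have Z: "Z > 0" unfolding Z_def by (rule indep_gf_pos[OF fin t])
    obtain A where A: "A \<in> indeps (?F J)" "(\<Sum>u\<in>?F J. t u) \<le> r * (\<Sum>u\<in>A. t u)"
      using A[of "?F J"] by auto
    have "Z * ln Z \<le> K * E J"
      unfolding Z_def E_def by (rule ln_indep_gf_le[OF fin t r K A])
    then have "(1 + w) * Z - K * E J \<le> Z * (1 + (w - ln Z))" by (simp add: algebra_simps)
    also have "\<dots> \<le> Z * exp (w - ln Z)"
      using Z by (intro mult_left_mono exp_ge_add_one_self) auto
    also have "\<dots> = exp w" using Z by (simp add: exp_diff)
    finally show "(1 + w) * indep_gf t (?F J) - K * E J \<le> exp w" by (simp add: Z_def)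
  qed
  finally show ?thesis by (simp add: indep_gf_def sum_distrib_left mult.commute)
qed

text \<open>
  The partial derivative of \<open>ln (indep_gf t V)\<close> in \<open>t u\<close> is the probability that no neighbor of \<open>u\<close> is
  occupied.
\<close>
lemma indep_gf_has_derivative:
  assumes "\<And>u. u \<in> V \<Longrightarrow> (\<tau> u has_real_derivative \<tau>' u) (at x)"
  shows "((\<lambda>x. indep_gf (\<lambda>u. \<tau> u x) V) has_real_derivative
    (\<Sum>u\<in>V. \<tau>' u * indep_gf (\<lambda>u. \<tau> u x) (V - nb u))) (at x)"
proof -
  let ?t = "\<lambda>u. \<tau> u x"
  have fin: "finite (indeps V)" by (rule finite_indeps[OF finite_V])
  have inter: "V \<inter> I = I" if "I \<in> indeps V" for I
    using that unfolding indeps_def by blast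
  have "((\<lambda>x. indep_gf (\<lambda>u. \<tau> u x) V) has_real_derivative
      (\<Sum>I\<in>indeps V. \<Sum>u\<in>I. (\<tau>' u * exp (?t u)) * wt ?t (I - {u}))) (at x)"
    unfolding indep_gf_def wt_def
    by (intro DERIV_sum has_field_derivative_prod)
      (auto intro!: derivative_eq_intros assms simp: indeps_def)
  also have "(\<Sum>I\<in>indeps V. \<Sum>u\<in>I. (\<tau>' u * exp (?t u)) * wt ?t (I - {u})) =
      (\<Sum>I\<in>indeps V. \<Sum>u\<in>V. if u \<in> I then (\<tau>' u * exp (?t u)) * wt ?t (I - {u}) else 0)"
    by (rule sum.cong[OF refl]) (simp only: inter sum.inter_restrict[OF finite_V, symmetric])
  also have "\<dots> = (\<Sum>u\<in>V. \<Sum>I | I \<in> indeps V \<and> u \<in> I. (\<tau>' u * exp (?t u)) * wt ?t (I - {u}))"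
    by (subst sum.swap) (simp add: sum.If_cases fin Collect_conj_eq)
  also have "\<dots> = (\<Sum>u\<in>V. \<tau>' u * indep_gf ?t (V - nb u))"
  proof (rule sum.cong[OF refl])
    fix u assume u: "u \<in> V"
    have "(\<Sum>I | I \<in> indeps V \<and> u \<in> I. (\<tau>' u * exp (?t u)) * wt ?t (I - {u})) =
        (\<Sum>J\<in>indeps (V - nb u - {u}). (\<tau>' u * exp (?t u)) * wt ?t J)"
      by (rule sum_indeps_remove[OF u])
    also have "\<dots> = \<tau>' u * (exp (?t u) * indep_gf ?t (V - nb u - {u}))"
      by (simp add: indep_gf_def sum_distrib_left mult.assoc)
    also have "\<dots> = \<tau>' u * indep_gf ?t (V - nb u)"
      by (simp only: indep_gf_minus_nb[OF u])
    finally show "(\<Sum>I | I \<in> indeps V \<and> u \<in> I. (\<tau>' u * exp (?t u)) * wt ?t (I - {u})) =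
        \<tau>' u * indep_gf ?t (V - nb u)" .
  qed
  finally show ?thesis .
qed

section \<open>Growth of the partition function along a path\<close>

lemma sum_nb_swap:
  "(\<Sum>v\<in>V. \<Sum>u\<in>nb v. h u) = (\<Sum>u\<in>V. real (card (nb u)) * h u)"
proof -
  have "(\<Sum>v\<in>V. \<Sum>u\<in>nb v. h u) = (\<Sum>u\<in>V. \<Sum>v | v \<in> V \<and> adj v u. h u)"
    unfolding nb_def by (rule sum.swap_restrict[OF finite_V finite_V])
  also have "\<dots> = (\<Sum>u\<in>V. real (card (nb u)) * h u)"
    by (intro sum.cong refl) (auto simp: nb_def intro!: arg_cong[of _ _ card] adj_sym)
  finally show ?thesis .
qed

text \<open>
  Sums \<open>indep_gf_minus_nbhd_ge\<close> with \<open>N = nb v\<close> over the active vertices \<open>v\<close>. In the double sum of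
  \<open>t u * indep_gf t (V - nb u)\<close> over \<open>v\<close> and \<open>u \<in> nb v\<close>, each \<open>u\<close> occurs at most as often as its
  degree, so the error terms can be charged to \<open>u\<close> itself. The right-hand side is then the derivative
  of \<open>indep_gf t V\<close> when each active \<open>t v\<close> moves with a velocity given by \<open>w v\<close>, \<open>t v\<close> and the degree of
  \<open>v\<close>, while the other vertices rest at \<open>t v = 0\<close>.
\<close>
lemma indep_gf_log_derivative_ge:
  assumes r: "r \<ge> 1" and K: "K \<ge> 1" "K - 1 = ln (r * K)"
    and A: "\<And>v F t. v \<in> V \<Longrightarrow> F \<subseteq> nb v \<Longrightarrow> (\<And>u. t u \<ge> (0::real)) \<Longrightarrow>
      \<exists>A\<in>indeps F. (\<Sum>u\<in>F. t u) \<le> r * (\<Sum>u\<in>A. t u)"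
    and t: "\<And>u. t u \<ge> 0"
    and act: "act \<subseteq> V" "\<And>u. u \<in> V - act \<Longrightarrow> t u = 0"
  shows "(\<Sum>v\<in>act. 1 + w v) * indep_gf t V
    \<le> (\<Sum>v\<in>act. (exp (w v) + K * real (card (nb v)) * t v) * indep_gf t (V - nb v))"
proof -
  define h where "h = (\<lambda>u. t u * indep_gf t (V - nb u))"
  have h: "h u \<ge> 0" for u
    unfolding h_def using t finite_V by (intro mult_nonneg_nonneg less_imp_le[OF indep_gf_pos]) auto
  have "(\<Sum>v\<in>act. \<Sum>u\<in>nb v. h u) \<le> (\<Sum>v\<in>V. \<Sum>u\<in>nb v. h u)"
    using act h finite_V by (intro sum_mono2 sum_nonneg) auto
  also have "\<dots> = (\<Sum>v\<in>act. real (card (nb v)) * h v)"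
    unfolding sum_nb_swap
    by (rule sum.mono_neutral_right) (use act finite_V in \<open>auto simp: h_def\<close>)
  finally have "K * (\<Sum>v\<in>act. \<Sum>u\<in>nb v. h u) \<le> K * (\<Sum>v\<in>act. real (card (nb v)) * h v)"
    using K by (intro mult_left_mono) auto
  moreover have "(\<Sum>v\<in>act. (1 + w v) * indep_gf t V - K * (\<Sum>u\<in>nb v. h u)) \<le>
      (\<Sum>v\<in>act. exp (w v) * indep_gf t (V - nb v))"
  proof (rule sum_mono)
    fix v assume "v \<in> act"
    then have v: "v \<in> V" using act by auto
    show "(1 + w v) * indep_gf t V - K * (\<Sum>u\<in>nb v. h u) \<le> exp (w v) * indep_gf t (V - nb v)"
      unfolding h_def
      by (rule indep_gf_minus_nbhd_ge[OF _ t r K A[OF v _ t]]) (auto simp: nb_def)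
  qed
  ultimately show ?thesis
    by (simp add: h_def sum.distrib sum_subtractf sum_distrib_left sum_distrib_right algebra_simps)
qed

text \<open>
  The path realizing \<open>indep_gf_log_derivative_ge\<close>: a vertex that has been active for time \<open>y\<close> has
  \<open>t = y * exp (a * y)\<close>, and with tangent point \<open>w = a * y\<close> its velocity is
  \<open>exp w * (1 + w) = exp w + a * t\<close>, as that lemma requires. The guaranteed growth
  rate \<open>1 + a * y\<close> integrates to \<open>y + a * y\<^sup>2 / 2\<close>. Vertices of different degree need different
  times \<open>s v\<close>, so \<open>v\<close> is switched on at \<open>T - s v\<close> and all of them finish together at time \<open>T\<close>;
  the opposite order, with a common start, would leave vertices with positive activity at rest, and
  for those the charging argument fails.
\<close>
lemma ln_indep_gf_ge:
  assumes r: "r \<ge> 1" and K: "K \<ge> 1" "K - 1 = ln (r * K)"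
    and A: "\<And>v F t. v \<in> V \<Longrightarrow> F \<subseteq> nb v \<Longrightarrow> (\<And>u. t u \<ge> (0::real)) \<Longrightarrow>
      \<exists>A\<in>indeps F. (\<Sum>u\<in>F. t u) \<le> r * (\<Sum>u\<in>A. t u)"
    and s: "\<And>v. s v \<ge> 0"
  defines "a \<equiv> \<lambda>v. K * real (card (nb v))"
  shows "(\<Sum>v\<in>V. s v + a v * (s v)\<^sup>2 / 2) \<le> ln (indep_gf (\<lambda>v. s v * exp (a v * s v)) V)"
proof -
  define T where "T = (\<Sum>v\<in>V. s v)"
  define y where "y = (\<lambda>v x. max 0 (x - (T - s v)))"
  define \<tau> where "\<tau> = (\<lambda>v x. y v x * exp (a v * y v x))"
  define f where "f = (\<lambda>x. ln (indep_gf (\<lambda>v. \<tau> v x) V) - (\<Sum>v\<in>V. y v x + a v * (y v x)\<^sup>2 / 2))"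
  have sT: "s v \<le> T" if "v \<in> V" for v
    unfolding T_def using that s by (intro member_le_sum finite_V) auto
  have T: "T \<ge> 0" unfolding T_def using s by (rule sum_nonneg)
  have \<tau>: "\<tau> v x \<ge> 0" for v x by (simp add: \<tau>_def y_def)
  have Zpos: "indep_gf (\<lambda>v. \<tau> v x) V > 0" for x by (rule indep_gf_pos[OF finite_V \<tau>])
  have "f 0 \<le> f T"
  proof (rule nondecreasing_except_finite[where f = f and a = 0 and b = T and S = "(\<lambda>v. T - s v) ` V"])
    show "continuous_on {0..T} f"
      unfolding f_def
    proof (intro continuous_on_diff continuous_on_ln)
      show "continuous_on {0..T} (\<lambda>x. indep_gf (\<lambda>v. \<tau> v x) V)"
        unfolding indep_gf_def wt_def \<tau>_def y_def by (intro continuous_intros)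
      show "continuous_on {0..T} (\<lambda>x. \<Sum>v\<in>V. y v x + a v * (y v x)\<^sup>2 / 2)"
        unfolding y_def by (intro continuous_intros) auto
      show "\<forall>x\<in>{0..T}. indep_gf (\<lambda>v. \<tau> v x) V \<noteq> 0" using Zpos by (auto simp: less_imp_neq[symmetric])
    qed
  next
    fix x assume x: "x \<notin> (\<lambda>v. T - s v) ` V"
    define act where "act = {v\<in>V. x > T - s v}"
    define \<delta> where "\<delta> = (\<lambda>v. if v \<in> act then 1 else 0 :: real)"
    let ?t = "\<lambda>v. \<tau> v x"
    have y': "(y v has_real_derivative \<delta> v) (at x)" if v: "v \<in> V" for v
    proof (cases "v \<in> act")
      case True
      have "((\<lambda>x. x - (T - s v)) has_real_derivative 1) (at x)"
        by (auto intro!: derivative_eq_intros)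
      then have "(y v has_real_derivative 1) (at x)"
        by (rule has_field_derivative_transform_within_open[where S = "{T - s v<..}"])
          (use True in \<open>auto simp: y_def act_def\<close>)
      then show ?thesis using True by (simp add: \<delta>_def)
    next
      case False
      have "x \<noteq> T - s v" using x v by auto
      with False v have less: "x < T - s v" by (simp add: act_def)
      have "((\<lambda>x. 0) has_real_derivative 0) (at x)" by simp
      then have "(y v has_real_derivative 0) (at x)"
        by (rule has_field_derivative_transform_within_open[where S = "{..<T - s v}"])
          (use less in \<open>auto simp: y_def\<close>)
      then show ?thesis using False by (simp add: \<delta>_def)
    qed
    define w where "w = (\<lambda>v. a v * y v x)"
    have \<tau>': "(\<tau> v has_real_derivative \<delta> v * (exp (w v) + a v * ?t v)) (at x)" if "v \<in> V" for v
      unfolding \<tau>_def w_def by (auto intro!: derivative_eq_intros y'[OF that] simp: algebra_simps)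
    have der: "(f has_real_derivative
       (\<Sum>v\<in>V. \<delta> v * (exp (w v) + a v * ?t v) * indep_gf ?t (V - nb v)) / indep_gf ?t V
       - (\<Sum>v\<in>V. \<delta> v * (1 + w v))) (at x)"
      unfolding f_def
      by (rule derivative_eq_intros indep_gf_has_derivative y' \<tau>' Zpos refl | assumption)+
        (auto simp: w_def algebra_simps intro!: sum.cong)
    have ineq: "(\<Sum>v\<in>act. 1 + w v) * indep_gf ?t V
        \<le> (\<Sum>v\<in>act. (exp (w v) + K * real (card (nb v)) * ?t v) * indep_gf ?t (V - nb v))"
      by (rule indep_gf_log_derivative_ge[OF r K A \<tau>]) (auto simp: act_def \<tau>_def y_def)
    have drop_\<delta>: "(\<Sum>v\<in>V. \<delta> v * g v) = (\<Sum>v\<in>act. g v)" for g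
      unfolding \<delta>_def using finite_V
      by (intro sum.mono_neutral_cong_right) (auto simp: act_def)
    have "0 \<le> (\<Sum>v\<in>V. \<delta> v * (exp (w v) + a v * ?t v) * indep_gf ?t (V - nb v)) / indep_gf ?t V
       - (\<Sum>v\<in>V. \<delta> v * (1 + w v))"
      using ineq Zpos[of x] by (simp add: mult.assoc drop_\<delta> a_def pos_le_divide_eq)
    with der show "\<exists>D. (f has_real_derivative D) (at x) \<and> D \<ge> 0" by blast
  qed (use finite_V T in auto)
  moreover have y0: "y v 0 = 0" if "v \<in> V" for v using sT[OF that] by (simp add: y_def)
  then have "indep_gf (\<lambda>v. \<tau> v 0) V \<le> 1"
    using indep_gf_le_exp[of V "\<lambda>v. \<tau> v 0", OF finite_V \<tau>] by (simp add: \<tau>_def)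
  with indep_gf_ge_1[of V "\<lambda>v. \<tau> v 0", OF finite_V \<tau>] have "f 0 = 0" by (simp add: f_def y0)
  moreover have "y v T = s v" for v using s[of v] by (simp add: y_def)
  ultimately show ?thesis by (simp add: f_def \<tau>_def)
qed

end

section \<open>Fractional colorings and the bound\<close>

text \<open>
  The random set meets \<open>F\<close> in expected weight exactly \<open>1 / r\<close> times the weight of \<open>F\<close>, and some set in
  its support reaches the mean.
\<close>
lemma weighted_indep_of_pmf:
  fixes p :: "'a set pmf" and t :: "'a \<Rightarrow> real"
  assumes fin: "finite (set_pmf p)" and F: "finite F" and r: "r > 0"
    and p: "\<And>u. u \<in> F \<Longrightarrow> measure_pmf.prob p {I. u \<in> I} = 1 / r"
  shows "\<exists>I\<in>set_pmf p. (\<Sum>u\<in>F. t u) \<le> r * (\<Sum>u\<in>I \<inter> F. t u)"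
proof (rule ccontr)
  let ?S = "set_pmf p"
  assume "\<not> ?thesis"
  then have less: "r * (\<Sum>u\<in>I \<inter> F. t u) < (\<Sum>u\<in>F. t u)" if "I \<in> ?S" for I
    using that by (meson not_le)
  have mass: "(\<Sum>I\<in>?S. pmf p I) = 1" using fin by (simp add: sum_pmf_eq_1)
  have prob: "(\<Sum>I\<in>?S. pmf p I * (if u \<in> I then 1 else 0)) = 1 / r" if "u \<in> F" for u
  proof -
    have "1 / r = measure_pmf.prob p ({I. u \<in> I} \<inter> ?S)"
      using p[OF that] by (simp add: measure_Int_set_pmf)
    also have "\<dots> = (\<Sum>I\<in>?S. if u \<in> I then pmf p I else 0)"
      using fin by (simp add: measure_measure_pmf_finite sum.If_cases Int_commute Int_def)
    finally show ?thesis by (simp add: if_distrib cong: if_cong)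
  qed
  have "(\<Sum>I\<in>?S. pmf p I * (r * (\<Sum>u\<in>I \<inter> F. t u))) =
      (\<Sum>I\<in>?S. \<Sum>u\<in>F. r * t u * (pmf p I * (if u \<in> I then 1 else 0)))"
    by (intro sum.cong refl)
      (auto simp: sum_distrib_left Int_commute[of _ F] sum.inter_restrict[OF F] intro!: sum.cong)
  also have "\<dots> = (\<Sum>u\<in>F. r * t u * (\<Sum>I\<in>?S. pmf p I * (if u \<in> I then 1 else 0)))"
    by (subst sum.swap) (simp only: sum_distrib_left)
  also have "\<dots> = (\<Sum>u\<in>F. t u)"
    by (intro sum.cong refl) (use prob r in simp)
  also have "\<dots> = (\<Sum>I\<in>?S. pmf p I * (\<Sum>u\<in>F. t u))"
    by (simp add: mass flip: sum_distrib_right)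
  finally have "(\<Sum>I\<in>?S. pmf p I * (r * (\<Sum>u\<in>I \<inter> F. t u))) = (\<Sum>I\<in>?S. pmf p I * (\<Sum>u\<in>F. t u))" .
  moreover have "(\<Sum>I\<in>?S. pmf p I * (r * (\<Sum>u\<in>I \<inter> F. t u))) < (\<Sum>I\<in>?S. pmf p I * (\<Sum>u\<in>F. t u))"
    using fin set_pmf_not_empty[of p] less
    by (intro sum_strict_mono mult_strict_left_mono) (auto simp: pmf_positive)
  ultimately show False by simp
qed

theorem theorem7:
  fixes G :: "('a, 'b) pre_digraph" and r lam :: real
  assumes "r \<ge> 1"
    and "graph G"
    and "frac_colorable_nbhds G r"
    and "lam > 0"
  shows "ln (indep_poly G lam) \<ge> (\<Sum>v\<in>verts G. local_term r (deg G v) lam)"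
proof -
  interpret graph G by fact
  interpret H: fin_simple_graph "verts G" "\<lambda>u v. u \<rightarrow>\<^bsub>G\<^esub> v"
  proof
    show "finite (verts G)" by (rule finite_verts)
    show "v \<rightarrow>\<^bsub>G\<^esub> u" if "u \<rightarrow>\<^bsub>G\<^esub> v" for u v
      using arcs_ends_symmetric[OF sym_arcs that] .
    show "\<not> u \<rightarrow>\<^bsub>G\<^esub> u" for u using adj_not_same[of u] by blast
  qed
  define K where "K = K_of r"
  have K: "K \<ge> 1" "K - 1 = ln (r * K)" unfolding K_def by (rule K_of_props[OF assms(1)])+
  define c where "c = ln (1 + lam)"
  have c: "c > 0" "exp c = 1 + lam" using assms(4) by (auto simp: c_def)
  have nb: "H.nb v = nbhd G v" for v
    by (auto simp: H.nb_def nbhd_def adj_in_verts)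
  define a where "a = (\<lambda>v. K * real (card (H.nb v)))"
  have a: "a v \<ge> 0" for v using K by (simp add: a_def)
  define s where "s = (\<lambda>v. if a v = 0 then c else lambert_W (a v * c) / a v)"
  have W: "lambert_W (a v * c) \<ge> 0" "lambert_W (a v * c) * exp (lambert_W (a v * c)) = a v * c" for v
    using lambert_W_props[of "a v * c"] a c by auto
  have s: "s v \<ge> 0" for v using W a c by (simp add: s_def)
  \<comment> \<open>These durations bring every vertex to the common activity \<open>exp c - 1 = lam\<close>.\<close>
  have s_end: "s v * exp (a v * s v) = c" for v
    using W(2)[of v] by (simp add: s_def field_simps)
  have local: "s v + a v * (s v)\<^sup>2 / 2 = local_term r (deg G v) lam" for v
    using K unfolding local_term_def deg_def area_def nb[symmetric] K_def[symmetric] c_def[symmetric]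
    by (auto simp: s_def a_def power2_eq_square field_simps)
  have indep: "\<exists>A\<in>H.indeps F. (\<Sum>u\<in>F. t u) \<le> r * (\<Sum>u\<in>A. t u)"
    if v: "v \<in> verts G" and F: "F \<subseteq> H.nb v" for v F and t :: "'a \<Rightarrow> real"
  proof -
    have finN: "finite (nbhd G v)"
      unfolding nb[symmetric] H.nb_def using H.finite_V by simp
    obtain p :: "'a set pmf" where p: "set_pmf p \<subseteq> indep_sets_of (G \<restriction> nbhd G v)"
      "\<And>u. u \<in> nbhd G v \<Longrightarrow> measure_pmf.prob p {I. u \<in> I} = 1 / r"
      using assms(3) v unfolding frac_colorable_nbhds_def by blast
    have "indep_sets_of (G \<restriction> nbhd G v) \<subseteq> Pow (nbhd G v)" by (auto simp: indep_sets_of_def)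
    then have "finite (set_pmf p)" using p(1) finN by (meson finite_Pow_iff finite_subset)
    moreover have "finite F" using F finN nb by (auto intro: finite_subset)
    ultimately obtain I where I: "I \<in> set_pmf p" "(\<Sum>u\<in>F. t u) \<le> r * (\<Sum>u\<in>I \<inter> F. t u)"
      using weighted_indep_of_pmf[of p F r t] p(2) F nb assms(1) by auto
    have induced: "u \<rightarrow>\<^bsub>G \<restriction> nbhd G v\<^esub> u'"
      if "u \<rightarrow>\<^bsub>G\<^esub> u'" "u \<in> nbhd G v" "u' \<in> nbhd G v" for u u'
    proof -
      from that(1) obtain e where "e \<in> arcs G" "tail G e = u" "head G e = u'" by (rule reachableE)
      with that(2,3) show ?thesis
        unfolding arcs_ends_conv induce_subgraph_def by (intro image_eqI[where x = e]) simp_all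
    qed
    have "I \<in> indep_sets_of (G \<restriction> nbhd G v)" using I(1) p(1) by blast
    then have "\<not> u \<rightarrow>\<^bsub>G\<^esub> u'" if "u \<in> I" "u' \<in> I" for u u'
      using that induced[of u u'] unfolding indep_sets_of_def induce_subgraph_verts by blast
    then have "I \<inter> F \<in> H.indeps F" unfolding H.indeps_def by blast
    with I(2) show ?thesis by blast
  qed
  have "(\<Sum>v\<in>verts G. local_term r (deg G v) lam) = (\<Sum>v\<in>verts G. s v + a v * (s v)\<^sup>2 / 2)"
    by (simp add: local)
  also have "\<dots> \<le> ln (H.indep_gf (\<lambda>v. s v * exp (a v * s v)) (verts G))"
    using H.ln_indep_gf_ge[OF assms(1) K indep s] unfolding a_def .
  also have "H.indep_gf (\<lambda>v. s v * exp (a v * s v)) (verts G) = indep_poly G lam"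
    unfolding s_end H.indep_gf_def indep_poly_def
    by (intro sum.cong) (auto simp: H.indeps_def indep_sets_of_def wt_def c)
  finally show ?thesis .
qed

end
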